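(* There is an infinite word $\mathbf{w}$ over the ternary alphabet $\{0,1,2\}$ such that $\mathbf{w}$ is $(9/4)^+$-free and its curling-number transform $C(\mathbf{w})$ is overlap-free.
   Context: Words are indexed from $0$; infinite words are one-sided, $\mathbf{w} = \mathbf{w}[0]\mathbf{w}[1]\cdots$; $x[i..j]$ denotes the factor (contiguous block) $x[i]\cdots x[j]$. A finite word $x$ of length $n \ge 1$ has period $p$, $1\le p\le n$, if $x[i]=x[i+p]$ for all $0\le i<n-p$; its exponent is $n/p$ where $p$ is its least period. A finite or infinite word is $\alpha^+$-free if it has no nonempty finite factor of exponent strictly greater than $\alpha$. An overlap is a word of the form $a x a x a$ with $a$ a single letter and $x$ a possibly empty word; a word is overlap-free if it contains no overlap as a factor (equivalently, it is $2^+$-free). The curling number of a nonempty finite word $u$ is the largest integer $k \ge 1$ such that $u = y z^k$ for some (possibly empty) word $y$ and some nonempty word $z$. For a finite or infinite word $x$, the curling-number transform $C(x)$ is the word over the positive integers, of the same length as $x$, whose $i$-th letter $C(x)[i]$ is the curling number of the prefix $x[0..i]$. *)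

theory Defs
  imports Complex_Main "HOL-Library.Omega_Words_Fun"
begin

text \<open>
  Finite words are lists and infinite words are functions from \<^typ>\<open>nat\<close>, as in
  \<^theory>\<open>HOL-Library.Omega_Words_Fun\<close>. There \<open>w [i \<rightarrow> j]\<close> denotes the block
  \<open>w i, ..., w (j - 1)\<close>, with the right end excluded.
\<close>

definition factor_of :: "'a list \<Rightarrow> 'a word \<Rightarrow> bool"
  where "factor_of u w \<longleftrightarrow> (\<exists>i j. i \<le> j \<and> u = w [i \<rightarrow> j])"

definition has_period :: "'a list \<Rightarrow> nat \<Rightarrow> bool"
  where "has_period x p \<longleftrightarrow>
    1 \<le> p \<and> p \<le> length x \<and> (\<forall>i. i + p < length x \<longrightarrow> x ! i = x ! (i + p))"

text \<open>Only meaningful for nonempty words, which have at least their length as a period.\<close>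

definition exponent :: "'a list \<Rightarrow> real"
  where "exponent x = real (length x) / real (LEAST p. has_period x p)"

definition plus_free :: "real \<Rightarrow> 'a word \<Rightarrow> bool"
  where "plus_free \<alpha> w \<longleftrightarrow>
    \<not> (\<exists>u. u \<noteq> [] \<and> factor_of u w \<and> exponent u > \<alpha>)"

definition is_overlap :: "'a list \<Rightarrow> bool"
  where "is_overlap u \<longleftrightarrow> (\<exists>a x. u = [a] @ x @ [a] @ x @ [a])"

definition overlap_free :: "'a word \<Rightarrow> bool"
  where "overlap_free w \<longleftrightarrow> \<not> (\<exists>u. factor_of u w \<and> is_overlap u)"

definition curling_exponents :: "'a list \<Rightarrow> nat set"
  where "curling_exponents u =
    {k. k \<ge> 1 \<and> (\<exists>y z. z \<noteq> [] \<and> u = y @ concat (replicate k z))}"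

definition curling_number :: "'a list \<Rightarrow> nat"
  where "curling_number u = Max (curling_exponents u)"

definition curling_transform :: "'a word \<Rightarrow> nat word"
  where "curling_transform w = (\<lambda>i. curling_number (w [0 \<rightarrow> Suc i]))"

lemma has_period_length: "x \<noteq> [] \<Longrightarrow> has_period x (length x)"
  by (cases x) (auto simp: has_period_def)

text \<open>For nonempty words, the maximum in \<^const>\<open>curling_number\<close> is over a finite nonempty set.\<close>

lemma finite_curling_exponents: "finite (curling_exponents u)"
proof (rule finite_subset)
  show "curling_exponents u \<subseteq> {..length u}"
  proof
    fix k assume "k \<in> curling_exponents u"
    then obtain y z where "z \<noteq> []" and u: "u = y @ concat (replicate k z)"
      by (auto simp: curling_exponents_def)
    then have "k * 1 \<le> k * length z"
      by (intro mult_le_mono2) (simp add: Suc_le_eq)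
    also have "\<dots> \<le> length u"
      by (simp add: u length_concat sum_list_replicate)
    finally show "k \<in> {..length u}" by simp
  qed
qed simp

lemma one_in_curling_exponents: "u \<noteq> [] \<Longrightarrow> 1 \<in> curling_exponents u"
  unfolding curling_exponents_def by (auto intro: exI[of _ "[]"] exI[of _ u])

end

theory Submission
  imports Defs
begin

text \<open>
  The word is a suffix of a 16-uniform image of the Thue-Morse word \<open>t\<close>, recoded by overlapping
  windows of three letters. A square in this recoding would be an overlap in \<open>t\<close>, so the recoding is square-free, and
  the image contains only squares of period at most 4. Where these end is therefore a local property,
  and the image is chosen so that a square ends at a position exactly when the corresponding letter
  of \<open>t\<close> is 1. There are no cubes, so the curling-number transform is a suffix of \<open>t\<close> written with
  the letters 1 and 2, and it inherits overlap-freeness.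
\<close>

section \<open>The Thue-Morse word and its overlap-freeness\<close>

fun tm :: "nat \<Rightarrow> bool" where
  "tm n = (if n = 0 then False else tm (n div 2) \<noteq> odd n)"

declare tm.simps [simp del]

lemma tm_even: "tm (2 * n) = tm n"
  by (cases "n = 0") (auto simp: tm.simps [of "2 * n"])

lemma tm_odd: "tm (Suc (2 * n)) = (\<not> tm n)"
  by (simp add: tm.simps [of "Suc (2 * n)"])

text \<open>Any three consecutive positions contain a pair \<open>2 * k\<close>,
  \<open>2 * k + 1\<close>, whose letters are complementary.\<close>

lemma tm_cube_free: "\<not> (tm (Suc n) = tm n \<and> tm (Suc (Suc n)) = tm n)"
proof (cases "even n")
  case True
  then obtain k where "n = 2 * k" by (auto elim: evenE)
  then show ?thesis by (simp add: tm_even tm_odd)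
next
  case False
  then obtain k where "n = Suc (2 * k)" by (auto elim: oddE)
  then show ?thesis
    using tm_even [of "Suc k"] tm_odd [of "Suc k"] by auto
qed

text \<open>An overlap of period \<open>p\<close> is a run of \<open>p + 1\<close> matches at
  distance \<open>p\<close>. Descent on \<open>p\<close>: if \<open>p\<close> is even, the positions
  of one parity carry an overlap of half the period; if \<open>p\<close> is odd, three equal
  consecutive letters are forced.\<close>

lemma tm_overlap_free:
  assumes "p \<ge> 1"
  shows "\<not> (\<forall>j\<le>p. tm (s + j) = tm (s + j + p))"
  using assms
proof (induction p arbitrary: s rule: less_induct)
  case (less p)
  show ?case
  proof
    assume eq: "\<forall>j\<le>p. tm (s + j) = tm (s + j + p)"
    have eq': "tm n = tm (n + p)" if "s \<le> n" "n \<le> s + p" for n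
      using eq [rule_format, of "n - s"] that by auto
    show False
    proof (cases "even p")
      case True
      then obtain q where q: "p = 2 * q" by (auto elim: evenE)
      have "tm (s div 2 + j) = tm (s div 2 + j + q)" if "j \<le> q" for j
      proof (cases "even s")
        case True
        then have "s = 2 * (s div 2)" by auto
        then show ?thesis
          using eq' [of "2 * (s div 2 + j)"] that tm_even [of "s div 2 + j"]
            tm_even [of "s div 2 + j + q"]
          by (simp add: q algebra_simps)
      next
        case False
        then have "s = Suc (2 * (s div 2))" by auto
        then show ?thesis
          using eq' [of "Suc (2 * (s div 2 + j))"] that tm_odd [of "s div 2 + j"]
            tm_odd [of "s div 2 + j + q"]
          by (simp add: q algebra_simps)
      qed
      then show False
        using less.IH [of q "s div 2"] less.prems q by auto
    next
      case False
      then obtain q where q: "p = Suc (2 * q)" by (auto elim: oddE)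
      \<comment> \<open>The pair at \<open>2 * k\<close>, \<open>2 * k + 1\<close> is complementary.
        At odd distance it matches a pair straddling the images of letters \<open>k + q\<close> and
        \<open>k + q + 1\<close>, and such a pair is complementary only if these two letters agree.
        In \<open>down\<close> the straddling pair is on the left.\<close>
      have up: "tm (k + q) = tm (Suc (k + q))" if "s \<le> 2 * k" "Suc (2 * k) \<le> s + p" for k
        using eq' [of "2 * k"] eq' [of "Suc (2 * k)"] that tm_even [of k] tm_odd [of k]
          tm_odd [of "k + q"] tm_even [of "Suc (k + q)"]
        by (simp add: q algebra_simps)
      have down: "tm k = tm (Suc k)" if "s \<le> Suc (2 * k)" "Suc (Suc (2 * k)) \<le> s + p" for k
        using eq' [of "Suc (2 * k)"] eq' [of "Suc (Suc (2 * k))"] that tm_odd [of k]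
          tm_even [of "Suc k"] tm_even [of "Suc (k + q)"] tm_odd [of "Suc (k + q)"]
        by (auto simp add: q algebra_simps)
      show False
      proof (cases "p = 1")
        case True
        then show False
          using eq' [of s] eq' [of "Suc s"] tm_cube_free [of s] by auto
      next
        case False
        then have "q \<ge> 1" using q by auto
        show False
        proof (cases "even s")
          case True
          then obtain k where "s = 2 * k" by (auto elim: evenE)
          then show False
            using up [of k] up [of "Suc k"] tm_cube_free [of "k + q"] \<open>q \<ge> 1\<close> q by auto
        next
          case False
          then obtain k where "s = Suc (2 * k)" by (auto elim: oddE)
          then show False
            using down [of k] down [of "Suc k"] tm_cube_free [of k] \<open>q \<ge> 1\<close> q by auto
        qed
      qed
    qed
  qed
qed

section \<open>Finite sets containing the short factors of the Thue-Morse word\<close>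

fun mu :: "bool list \<Rightarrow> bool list" where
  "mu [] = []"
| "mu (x # xs) = x # (\<not> x) # mu xs"

lemma mu_tm: "mu (map tm [i..<i + m]) = map tm [2 * i..<2 * i + 2 * m]"
proof (induction m arbitrary: i)
  case (Suc m)
  have "[i..<i + Suc m] = i # [Suc i..<Suc i + m]"
    by (simp add: upt_conv_Cons)
  moreover have "[2 * i..<2 * i + 2 * Suc m] =
      2 * i # Suc (2 * i) # [2 * Suc i..<2 * Suc i + 2 * m]"
    by (simp add: upt_conv_Cons)
  ultimately show ?case
    by (simp only: list.map mu.simps Suc.IH tm_even tm_odd)
qed simp

text \<open>A factor of the Thue-Morse word starts at an even or at an odd position of its own image.\<close>

definition image_factors :: "nat \<Rightarrow> bool list list \<Rightarrow> bool list list" where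
  "image_factors n S = remdups (concat (map (\<lambda>x. [take n (mu x), take n (drop 1 (mu x))]) S))"

text \<open>An odd \<open>i\<close> loses the first of the \<open>2 * m\<close> letters of the
  image, hence the strict bound on \<open>n\<close>.\<close>

lemma tm_factor_step:
  assumes S: "\<And>k. map tm [k..<k + m] \<in> set S" and n: "n < 2 * m"
  shows "map tm [i..<i + n] \<in> set (image_factors n S)"
proof -
  define k where "k = i div 2"
  have "map tm [i..<i + n] = take n (mu (map tm [k..<k + m])) \<or>
        map tm [i..<i + n] = take n (drop 1 (mu (map tm [k..<k + m])))"
  proof (cases "even i")
    case True
    then have "i = 2 * k" by (auto simp: k_def)
    then show ?thesis
      using n by (simp only: mu_tm take_map) (simp add: take_upt)
  next
    case False
    then have "i = Suc (2 * k)" by (auto simp: k_def)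
    then show ?thesis
      using n by (simp only: mu_tm take_map drop_map) (simp add: take_upt drop_upt)
  qed
  then show ?thesis
    using S [of k] by (auto simp: image_factors_def)
qed

text \<open>A block depends on three consecutive letters, so 4 letters determine two adjacent blocks
  and 7 letters determine five. These are the windows of the finite checks below.\<close>

definition tm_factors4 :: "bool list list" where
  "tm_factors4 = image_factors 4 (image_factors 3 [[a, b]. a \<leftarrow> [False, True], b \<leftarrow> [False, True]])"

definition tm_factors7 :: "bool list list" where
  "tm_factors7 = image_factors 7 tm_factors4"

lemma tm_factors4: "map tm [i..<i + 4] \<in> set tm_factors4"
proof -
  have pairs: "map tm [k..<k + 2] \<in> set [[a, b]. a \<leftarrow> [False, True], b \<leftarrow> [False, True]]" for k
  proof -
    have "[k..<k + 2] = [k, Suc k]" by (simp add: upt_conv_Cons)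
    then show ?thesis
      by (simp only: list.map) auto
  qed
  have "map tm [k..<k + 3] \<in> set (image_factors 3 [[a, b]. a \<leftarrow> [False, True], b \<leftarrow> [False, True]])" for k
    by (rule tm_factor_step [where m = 2, OF pairs]) simp
  then show ?thesis
    unfolding tm_factors4_def by (rule tm_factor_step [where m = 3]) simp
qed

lemma tm_factors7: "map tm [i..<i + 7] \<in> set tm_factors7"
  unfolding tm_factors7_def by (rule tm_factor_step [OF tm_factors4]) simp

section \<open>The 16-uniform image\<close>

text \<open>This table was found by a computer search.\<close>

fun block :: "bool \<Rightarrow> bool \<Rightarrow> bool \<Rightarrow> nat list" where
  "block False False c = [1,1,2,0,1,1,2,0,0,2,0,2,2,1,1,0]"
| "block False True c = [1,1,0,2,1,1,0,2,1,0,0,2,1,0,2,1]"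
| "block True False False = [1,2,1,2,2,1,2,0,2,2,0,2,0,1,1,2]"
| "block True False True = [1,0,1,0,0,1,0,2,0,0,2,0,2,1,1,0]"
| "block True True c = [1,0,2,1,1,2,2,0,2,2,0,1,2,2,0,1]"

lemma length_block [simp]: "length (block a b c) = 16"
  by (cases a; cases b; cases c) auto

definition block_word :: "nat word" where
  "block_word m = block (tm (m div 16)) (tm (m div 16 + 1)) (tm (m div 16 + 2)) ! (m mod 16)"

lemma block_word_nth: "k < 16 \<Longrightarrow> block_word (16 * i + k) = block (tm i) (tm (i + 1)) (tm (i + 2)) ! k"
  by (simp add: block_word_def)

text \<open>Finite counterpart of \<open>block_word\<close>, on which the checks can be evaluated.
  The last two letters are lookahead: \<open>m + 2\<close> letters yield \<open>m\<close>
  blocks.\<close>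

fun blocks :: "bool list \<Rightarrow> nat list" where
  "blocks (a # b # c # xs) = block a b c @ blocks (b # c # xs)"
| "blocks xs = []"

lemma blocks_tm_Suc:
  "blocks (map tm [i..<i + (Suc m + 2)]) =
    block (tm i) (tm (i + 1)) (tm (i + 2)) @ blocks (map tm [Suc i..<Suc i + (m + 2)])"
proof -
  have *: "[i..<i + (Suc m + 2)] = i # Suc i # Suc (Suc i) # [Suc (Suc (Suc i))..<Suc i + (m + 2)]"
    and **: "[Suc i..<Suc i + (m + 2)] = Suc i # Suc (Suc i) # [Suc (Suc (Suc i))..<Suc i + (m + 2)]"
    by (simp_all add: upt_conv_Cons)
  show ?thesis
    unfolding * ** by simp
qed

lemma blocks_tm:
  assumes "n < 16 * m"
  shows "blocks (map tm [i..<i + (m + 2)]) ! n = block_word (16 * i + n)"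
  using assms
proof (induction m arbitrary: i n)
  case (Suc m)
  then show ?case
    using block_word_nth [of n i] Suc.IH [of "n - 16" "Suc i"]
    unfolding blocks_tm_Suc by (auto simp: nth_append)
qed simp

lemma length_blocks_tm: "length (blocks (map tm [i..<i + (m + 2)])) = 16 * m"
proof (induction m arbitrary: i)
  case 0
  then show ?case by (simp add: upt_conv_Cons)
next
  case (Suc m)
  show ?case
    by (simp only: blocks_tm_Suc length_append length_block Suc.IH mult_Suc_right)
qed

section \<open>Repetitions of period below 32\<close>

text \<open>A run of \<open>run_limit p\<close> consecutive matches at distance \<open>p\<close> is what must be excluded: for
  \<open>p \<le> 4\<close> it is the shortest one giving exponent above \<open>9 / 4\<close>, for \<open>p > 4\<close> it is a square.\<close>

definition run_limit :: "nat \<Rightarrow> nat" where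
  "run_limit p = (if p \<le> 4 then Suc p + p div 4 else p)"

text \<open>The argument \<open>c\<close> counts down the matches still allowed in the current run.\<close>

fun no_run :: "nat \<Rightarrow> nat \<Rightarrow> 'a list \<Rightarrow> 'a list \<Rightarrow> bool" where
  "no_run L c (x # xs) (y # ys) =
    (if x = y then (case c of 0 \<Rightarrow> False | Suc d \<Rightarrow> no_run L d xs ys) else no_run L L xs ys)"
| "no_run L c _ _ = True"

text \<open>The second conjunct carries the induction: it concerns the run in progress at the head
  of the lists, whose remaining allowance \<open>c\<close> may be smaller than
  \<open>L\<close>.\<close>

lemma no_run_sound:
  assumes "no_run L c xs ys" "c \<le> L"
  shows "(\<forall>s. s + L < length xs \<and> s + L < length ys \<longrightarrow> (\<exists>k\<le>L. xs ! (s + k) \<noteq> ys ! (s + k))) \<and>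
    (c < length xs \<and> c < length ys \<longrightarrow> (\<exists>k\<le>c. xs ! k \<noteq> ys ! k))"
  using assms
proof (induction L c xs ys rule: no_run.induct)
  case (1 L c x xs y ys)
  show ?case
  proof (cases "x = y")
    case False
    then have "no_run L L xs ys" using 1 by simp
    with 1(2) False have IH: "\<forall>s. s + L < length xs \<and> s + L < length ys \<longrightarrow> (\<exists>k\<le>L. xs ! (s + k) \<noteq> ys ! (s + k))"
      by simp
    show ?thesis
    proof (intro conjI allI impI)
      fix s assume s: "s + L < length (x # xs) \<and> s + L < length (y # ys)"
      show "\<exists>k\<le>L. (x # xs) ! (s + k) \<noteq> (y # ys) ! (s + k)"
      proof (cases s)
        case 0
        then show ?thesis using False by (intro exI [of _ 0]) simp
      next
        case (Suc t)
        then show ?thesis using IH s by auto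
      qed
    next
      show "\<exists>k\<le>c. (x # xs) ! k \<noteq> (y # ys) ! k"
        using False by (intro exI [of _ 0]) simp
    qed
  next
    case True
    then obtain d where d: "c = Suc d" "no_run L d xs ys"
      using 1(3) by (auto split: nat.splits)
    have IH: "\<forall>s. s + L < length xs \<and> s + L < length ys \<longrightarrow> (\<exists>k\<le>L. xs ! (s + k) \<noteq> ys ! (s + k))"
      "d < length xs \<and> d < length ys \<longrightarrow> (\<exists>k\<le>d. xs ! k \<noteq> ys ! k)"
      using 1(1) [OF True d] 1(4) d by auto
    show ?thesis
    proof (intro conjI allI impI)
      fix s assume s: "s + L < length (x # xs) \<and> s + L < length (y # ys)"
      show "\<exists>k\<le>L. (x # xs) ! (s + k) \<noteq> (y # ys) ! (s + k)"
      proof (cases s)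
        case 0
        then obtain k where "k \<le> d" "xs ! k \<noteq> ys ! k"
          using IH(2) s d 1(4) by auto
        then show ?thesis using 0 d 1(4) by (intro exI [of _ "Suc k"]) simp
      next
        case (Suc t)
        then show ?thesis using IH s by auto
      qed
    next
      assume "c < length (x # xs) \<and> c < length (y # ys)"
      then obtain k where "k \<le> d" "xs ! k \<noteq> ys ! k"
        using IH(2) d by auto
      then show "\<exists>k\<le>c. (x # xs) ! k \<noteq> (y # ys) ! k"
        using d by (intro exI [of _ "Suc k"]) simp
    qed
  qed
qed auto

lemma short_runs:
  "\<forall>x\<in>set tm_factors7. \<forall>p\<in>{1..<32}.
    no_run (run_limit p - 1) (run_limit p - 1) (blocks x) (drop p (blocks x))"
  unfolding set_upt [symmetric] by code_simp

lemma run_bound_short: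
  assumes "p \<ge> 1" "p < 32"
  shows "\<exists>k<run_limit p. block_word (s + k) \<noteq> block_word (s + k + p)"
proof -
  define i where "i = s div 16"
  define r where "r = s mod 16"
  \<comment> \<open>Five blocks suffice: the largest index compared is at most 15 + 61 = 76, below
    80.\<close>
  define X where "X = blocks (map tm [i..<i + (5 + 2)])"
  have s: "s = 16 * i + r" "r < 16" by (simp_all add: i_def r_def)
  have len: "length X = 80" by (simp only: X_def length_blocks_tm)
  have X: "X ! n = block_word (16 * i + n)" if "n < 80" for n
    unfolding X_def by (rule blocks_tm) (use that in simp)
  have lim: "run_limit p \<ge> 1" "run_limit p < p + 3" "run_limit p < 32" "run_limit p + p \<le> 62"
    using assms by (auto simp: run_limit_def)
  have "no_run (run_limit p - 1) (run_limit p - 1) X (drop p X)"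
    using short_runs tm_factors7 [of i] assms by (simp add: X_def)
  then have "\<forall>s. s + (run_limit p - 1) < length X \<and> s + (run_limit p - 1) < length (drop p X) \<longrightarrow>
      (\<exists>k\<le>run_limit p - 1. X ! (s + k) \<noteq> drop p X ! (s + k))"
    by (rule conjunct1 [OF no_run_sound]) simp
  moreover have "r + (run_limit p - 1) < length X" "r + (run_limit p - 1) < length (drop p X)"
    using lim s(2) by (simp_all add: len)
  ultimately obtain k where k: "k \<le> run_limit p - 1" "X ! (r + k) \<noteq> drop p X ! (r + k)"
    by blast
  then have "block_word (s + k) \<noteq> block_word (s + k + p)"
    using lim s(2) X [of "r + k"] X [of "p + (r + k)"] by (simp add: len s(1) algebra_simps)
  with k lim show ?thesis by (intro exI [of _ k]) auto
qed

section \<open>Synchronisation and squares of period at least 32\<close>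

lemma block_sync_check:
  "\<forall>x\<in>set tm_factors4. \<forall>r\<in>{1..<16}. \<forall>a\<in>set [False, True]. \<forall>b\<in>set [False, True].
    \<forall>c\<in>set [False, True]. take 16 (drop r (blocks x)) \<noteq> block a b c"
  unfolding set_upt [symmetric] by code_simp

text \<open>Meant for the incomplete blocks at the ends of a long square. At the right end the first
  letter of the window is matched already and the second is the new one; at the left end, treated by
  \<open>block_suffix\<close>, the first letter is new.\<close>

lemma block_prefix: "take 8 (block a b c) = take 8 (block a' b' c') \<Longrightarrow> b = b'"
  by (cases a; cases b; cases c; cases a'; cases b'; cases c') simp_all

lemma block_suffix: "drop 8 (block a b c) = drop 8 (block a' b' c') \<Longrightarrow> a = a'"
  by (cases a; cases b; cases c; cases a'; cases b'; cases c') simp_all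

text \<open>The copy of block \<open>i\<close> at distance \<open>p\<close> starts at offset
  \<open>p mod 16\<close> of some block, and \<open>block_sync_check\<close> excludes all nonzero
  offsets.\<close>

lemma block_sync:
  assumes eq: "\<And>k. k < 16 \<Longrightarrow> block_word (16 * i + k) = block_word (16 * i + k + p)"
  shows "p mod 16 = 0"
proof (rule ccontr)
  assume r0: "p mod 16 \<noteq> 0"
  define i' where "i' = i + p div 16"
  define r where "r = p mod 16"
  \<comment> \<open>The copy ends at offset \<open>r + 15\<close> \<le> 30, within the two blocks
    that four letters determine.\<close>
  define X where "X = blocks (map tm [i'..<i' + 4])"
  have p: "16 * i + p = 16 * i' + r" and r: "0 < r" "r < 16"
    using r0 by (simp_all add: i'_def r_def)
  have len: "length X = 32"
    using length_blocks_tm [of i' 2] by (simp add: X_def)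
  have X: "X ! n = block_word (16 * i' + n)" if "n < 32" for n
    using blocks_tm [of n 2 i'] that by (simp add: X_def)
  have "take 16 (drop r X) = block (tm i) (tm (i + 1)) (tm (i + 2))"
  proof (rule nth_equalityI)
    fix k assume "k < length (take 16 (drop r X))"
    then have k: "k < 16" by simp
    have *: "16 * i' + (r + k) = 16 * i + k + p" using p by simp
    then show "take 16 (drop r X) ! k = block (tm i) (tm (i + 1)) (tm (i + 2)) ! k"
      using k r X [of "r + k", unfolded *] eq [OF k] block_word_nth [OF k, of i] by (simp add: len)
  qed (use len r in simp)
  moreover have "map tm [i'..<i' + 4] \<in> set tm_factors4" by (rule tm_factors4)
  moreover have "r \<in> {1..<16}" using r by simp
  moreover have "b \<in> set [False, True]" for b by auto
  ultimately show False
    using block_sync_check unfolding X_def by blast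
qed

text \<open>Synchronisation makes the period \<open>p = 16 * q\<close>, so the \<open>q - 1\<close> complete blocks of the first half
  give \<open>q\<close> matching Thue-Morse letters at distance \<open>q\<close>. One of the two incomplete blocks has
  at least 8 letters and supplies the missing match of an overlap.\<close>

lemma no_long_square:
  assumes p: "p \<ge> 32"
  shows "\<exists>k<p. block_word (s + k) \<noteq> block_word (s + k + p)"
proof (rule ccontr)
  assume "\<not> ?thesis"
  then have all: "\<forall>k<p. block_word (s + k) = block_word (s + k + p)" by blast
  have eq: "block_word m = block_word (m + p)" if "s \<le> m" "m < s + p" for m
    using all [rule_format, of "m - s"] that by simp
  \<comment> \<open>Block \<open>i\<close> is the first one starting at or after \<open>s\<close>;
    \<open>b\<close> letters of the preceding block come before it.\<close>
  define i where "i = (s + 15) div 16"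
  define b where "b = 16 * i - s"
  have b: "16 * i = s + b" "b < 16"
    by (auto simp: b_def i_def)
  \<comment> \<open>Block \<open>i\<close> lies entirely in the first half, since
    \<open>b + 16\<close> \<le> 31 < \<open>p\<close>.\<close>
  have "p mod 16 = 0"
    by (rule block_sync [of i]) (rule eq; use b p in simp)
  then obtain q where q: "p = 16 * q" by (auto elim!: dvdE simp flip: dvd_eq_mod_eq_0)
  with p have "q \<ge> 2" by simp
  have block_eq: "block (tm j) (tm (j + 1)) (tm (j + 2)) ! k =
      block (tm (j + q)) (tm (j + q + 1)) (tm (j + q + 2)) ! k"
    if "k < 16" "s \<le> 16 * j + k" "16 * j + k < s + p" for j k
    using eq [OF that(2,3)] block_word_nth [OF that(1), of j] block_word_nth [OF that(1), of "j + q"]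
    by (simp add: q algebra_simps)
  have full: "tm (i + j) = tm (i + j + q)" "tm (i + j + 1) = tm (i + j + q + 1)"
    if "j + 2 \<le> q" for j
  proof -
    have "block (tm (i + j)) (tm (i + j + 1)) (tm (i + j + 2)) =
        block (tm (i + j + q)) (tm (i + j + q + 1)) (tm (i + j + q + 2))"
    proof (rule nth_equalityI)
      fix k assume "k < length (block (tm (i + j)) (tm (i + j + 1)) (tm (i + j + 2)))"
      then have "k < 16" "s \<le> 16 * (i + j) + k" "16 * (i + j) + k < s + p"
        using b q that by simp_all
      then show "block (tm (i + j)) (tm (i + j + 1)) (tm (i + j + 2)) ! k =
          block (tm (i + j + q)) (tm (i + j + q + 1)) (tm (i + j + q + 2)) ! k"
        by (rule block_eq)
    qed simp
    then show "tm (i + j) = tm (i + j + q)" "tm (i + j + 1) = tm (i + j + q + 1)"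
      by (metis block_suffix, metis block_prefix)
  qed
  have square: "tm (i + j) = tm (i + j + q)" if "j < q" for j
  proof (cases "j + 2 \<le> q")
    case True
    then show ?thesis by (rule full)
  next
    case False
    \<comment> \<open>The complete blocks are \<open>i\<close> to \<open>i + q - 2\<close>; letter
      \<open>i + q - 1\<close> is the second letter of the last window.\<close>
    then have "i + j = i + (q - 2) + 1" using \<open>q \<ge> 2\<close> that by simp
    then show ?thesis using full(2) [of "q - 2"] \<open>q \<ge> 2\<close> by (simp add: algebra_simps)
  qed
  show False
  proof (cases "b \<le> 8")
    case True
    \<comment> \<open>Block \<open>j\<close> is cut by the end of the first half, which contains its
      first \<open>16 - b\<close> \<ge> 8 letters. The overlap is extended on the right.\<close>
    define j where "j = i + q - 1"
    have j: "j + 1 = i + q" "16 * j + 16 = s + b + p"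
      using \<open>q \<ge> 2\<close> b q by (simp_all add: j_def)
    have "take 8 (block (tm j) (tm (j + 1)) (tm (j + 2))) =
        take 8 (block (tm (j + q)) (tm (j + q + 1)) (tm (j + q + 2)))"
    proof (rule nth_equalityI)
      fix k assume "k < length (take 8 (block (tm j) (tm (j + 1)) (tm (j + 2))))"
      then show "take 8 (block (tm j) (tm (j + 1)) (tm (j + 2))) ! k =
        take 8 (block (tm (j + q)) (tm (j + q + 1)) (tm (j + q + 2))) ! k"
        using block_eq [of k j] True j p by simp
    qed simp
    then have "tm (j + 1) = tm (j + q + 1)" by (rule block_prefix)
    then have "tm (i + q) = tm (i + q + q)" using j(1) by (metis add.assoc add.commute)
    with square have "\<forall>j\<le>q. tm (i + j) = tm (i + j + q)"
      by (metis le_neq_implies_less)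
    then show False using tm_overlap_free [of q i] \<open>q \<ge> 2\<close> by auto
  next
    case False
    \<comment> \<open>Block \<open>j\<close> is cut by the start of the square, which contains its
      last \<open>b\<close> \<ge> 9 letters. The overlap is extended on the left.\<close>
    define j where "j = i - 1"
    have j: "j + 1 = i" "16 * j + 16 = s + b"
      using False b by (auto simp: j_def)
    have "drop 8 (block (tm j) (tm (j + 1)) (tm (j + 2))) =
        drop 8 (block (tm (j + q)) (tm (j + q + 1)) (tm (j + q + 2)))"
    proof (rule nth_equalityI)
      fix k assume "k < length (drop 8 (block (tm j) (tm (j + 1)) (tm (j + 2))))"
      then show "drop 8 (block (tm j) (tm (j + 1)) (tm (j + 2))) ! k =
        drop 8 (block (tm (j + q)) (tm (j + q + 1)) (tm (j + q + 2))) ! k"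
        using block_eq [of "8 + k" j] False j p b by simp
    qed simp
    then have "tm j = tm (j + q)" by (rule block_suffix)
    with square j have "\<forall>k\<le>q. tm (j + k) = tm (j + k + q)"
      by (metis Suc_eq_plus1 Suc_le_eq add.right_neutral add_Suc_shift not0_implies_Suc)
    then show False using tm_overlap_free [of q j] \<open>q \<ge> 2\<close> by auto
  qed
qed

lemma run_bound:
  assumes "p \<ge> 1"
  shows "\<exists>k<run_limit p. block_word (s + k) \<noteq> block_word (s + k + p)"
proof (cases "p < 32")
  case True
  with assms show ?thesis by (rule run_bound_short)
next
  case False
  then show ?thesis using no_long_square [of p s] by (simp add: run_limit_def)
qed

section \<open>Positions where short squares end\<close>

text \<open>Eight letters are just enough for a square of period at most 4 ending at the last of
  them, so entry \<open>n\<close> concerns position \<open>n + 7\<close>.\<close>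

fun square_ends :: "'a list \<Rightarrow> bool list" where
  "square_ends (a # b # c # d # e # f # g # h # xs) =
    (h = g \<or> h = f \<and> g = e \<or> h = e \<and> g = d \<and> f = c \<or> h = d \<and> g = c \<and> f = b \<and> e = a) #
    square_ends (b # c # d # e # f # g # h # xs)"
| "square_ends xs = []"

lemma square_ends_nth:
  assumes "n + 7 < length xs"
  shows "square_ends xs ! n \<longleftrightarrow>
    (\<exists>p<5. 1 \<le> p \<and> (\<forall>k<p. xs ! (n + 7 - k) = xs ! (n + 7 - k - p)))"
proof -
  have "square_ends xs ! n \<longleftrightarrow>
     xs ! (n + 7) = xs ! (n + 6) \<or> xs ! (n + 7) = xs ! (n + 5) \<and> xs ! (n + 6) = xs ! (n + 4) \<or>
     xs ! (n + 7) = xs ! (n + 4) \<and> xs ! (n + 6) = xs ! (n + 3) \<and> xs ! (n + 5) = xs ! (n + 2) \<or>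
     xs ! (n + 7) = xs ! (n + 3) \<and> xs ! (n + 6) = xs ! (n + 2) \<and> xs ! (n + 5) = xs ! (n + 1) \<and>
       xs ! (n + 4) = xs ! n"
    using assms
  proof (induction xs arbitrary: n rule: square_ends.induct)
    case (1 a b c d e f g h xs)
    show ?case
    proof (cases n)
      case 0
      then show ?thesis by simp
    next
      case (Suc m)
      then show ?thesis using "1.IH" [of m] "1.prems" by simp
    qed
  qed simp_all
  then show ?thesis
    by (simp add: numeral_eq_Suc All_less_Suc Ex_less_Suc) (simp add: conj_ac disj_ac)
qed

text \<open>Four applications of \<open>mu\<close> to the factor at \<open>i\<close> list the
  Thue-Morse letters from position \<open>16 * i\<close>. Entry 1 of \<open>square_ends\<close>
  concerns offset 8 and is compared with offset 14, hence the shift by 6 in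
  \<open>squares_end_at\<close>.\<close>

lemma squares_check:
  "\<forall>x\<in>set tm_factors4. take 16 (drop 1 (square_ends (blocks x))) =
    take 16 (drop 14 (mu (mu (mu (mu x)))))"
  by code_simp

lemma squares_end_at:
  assumes "m \<ge> 8"
  shows "(\<exists>p<5. 1 \<le> p \<and> (\<forall>k<p. block_word (m - k) = block_word (m - k - p))) = tm (m + 6)"
proof -
  \<comment> \<open>The check covers the offsets 8 to 23, a complete residue system modulo 16, so
    every \<open>m\<close> \<ge> 8 is reached.\<close>
  define i where "i = (m - 8) div 16"
  define j where "j = (m - 8) mod 16"
  define x where "x = map tm [i..<i + 4]"
  have m: "m = 16 * i + (j + 8)" and j: "j < 16"
    using assms by (auto simp: i_def j_def)
  have len: "length (blocks x) = 32"
    using length_blocks_tm [of i 2] by (simp add: x_def)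
  have len': "length (square_ends xs) = length xs - 7" for xs :: "nat list"
    by (induction xs rule: square_ends.induct) auto
  have X: "blocks x ! n = block_word (16 * i + n)" if "n < 32" for n
    using blocks_tm [of n 2 i] that by (simp add: x_def)
  have mu: "mu (mu (mu (mu x))) = map tm [16 * i..<16 * i + 64]"
    unfolding x_def mu_tm by simp
  have "take 16 (drop 1 (square_ends (blocks x))) ! j = take 16 (drop 14 (mu (mu (mu (mu x))))) ! j"
    using squares_check tm_factors4 [of i] unfolding x_def by simp
  then have "square_ends (blocks x) ! (j + 1) = tm (m + 6)"
    using j by (simp add: len len' mu m ac_simps)
  moreover have elem: "blocks x ! (j + 1 + 7 - k) = block_word (m - k)"
    "blocks x ! (j + 1 + 7 - k - p) = block_word (m - k - p)" if "k < p" "p < 5" for k p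
    using X [of "j + 8 - k"] X [of "j + 8 - k - p"] that j unfolding m by (simp_all add: add.commute [of 8])
  have "(\<exists>p<5. 1 \<le> p \<and> (\<forall>k<p. blocks x ! (j + 1 + 7 - k) = blocks x ! (j + 1 + 7 - k - p))) =
      (\<exists>p<5. 1 \<le> p \<and> (\<forall>k<p. block_word (m - k) = block_word (m - k - p)))"
    by (rule ex_cong1, rule conj_cong [OF refl], rule conj_cong [OF refl], rule all_cong1,
        rule imp_cong [OF refl]) (simp only: elem)
  ultimately show ?thesis
    using square_ends_nth [of "j + 1" "blocks x"] j by (simp only: len)
qed

section \<open>The shifted word and its freeness\<close>

text \<open>The shift makes the squares that realise the first values of the curling transform lie
  entirely inside the word.\<close>

definition shifted_word :: "nat word" where
  "shifted_word n = block_word (n + 21)"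

lemma range_shifted_word: "range shifted_word \<subseteq> {0, 1, 2}"
proof -
  have "set (block a b c) \<subseteq> {0, 1, 2}" for a b c
    by (cases a; cases b; cases c) simp_all
  moreover have "block_word m \<in> set (block (tm (m div 16)) (tm (m div 16 + 1)) (tm (m div 16 + 2)))" for m
    unfolding block_word_def by (rule nth_mem) simp
  ultimately have "block_word m \<in> {0, 1, 2}" for m
    by (meson subsetD)
  then show ?thesis
    unfolding shifted_word_def by (rule image_subsetI)
qed

lemma shifted_word_run_bound: "p \<ge> 1 \<Longrightarrow> \<exists>k<run_limit p. shifted_word (s + k) \<noteq> shifted_word (s + k + p)"
  using run_bound [of p "s + 21"] by (simp add: shifted_word_def algebra_simps)

lemma plus_free_shifted_word: "plus_free (9 / 4) shifted_word"
  unfolding plus_free_def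
proof (intro notI, elim exE conjE)
  fix u assume u: "u \<noteq> []" "factor_of u shifted_word" "exponent u > 9 / 4"
  obtain i j where ij: "i \<le> j" "u = subsequence shifted_word i j"
    using u(2) by (auto simp: factor_of_def)
  define p where "p = (LEAST p. has_period u p)"
  have per: "has_period u p"
    unfolding p_def by (rule LeastI) (rule has_period_length [OF u(1)])
  then have p: "1 \<le> p" by (simp add: has_period_def)
  have "9 * p < 4 * length u"
    using u(3) p unfolding exponent_def p_def [symmetric] by (simp add: field_simps)
  \<comment> \<open>For \<open>p\<close> = 1, 2, 3, 4 the length is at least 3, 5, 7, 10, which is
    exactly \<open>run_limit p + p\<close>; for larger \<open>p\<close> it exceeds
    \<open>2 * p\<close>.\<close>
  then have le: "run_limit p + p \<le> length u"
    by (auto simp: run_limit_def)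
  obtain k where k: "k < run_limit p" "shifted_word (i + k) \<noteq> shifted_word (i + k + p)"
    using shifted_word_run_bound [OF p] by blast
  have "u ! k = u ! (k + p)"
    using per k(1) le by (simp add: has_period_def)
  then show False
    using k le ij by (simp add: subsequence_def add.assoc)
qed

section \<open>The curling-number transform\<close>

text \<open>Indices run backwards from the end of the square, which stays fixed while the period
  varies; this is the form of \<open>squares_end_at\<close>. The bound \<open>2 * p\<close> \<le>
  \<open>n\<close> keeps the subtractions from being truncated.\<close>

lemma square_suffix_iff:
  "(\<exists>y z. z \<noteq> [] \<and> prefix n v = y @ z @ z) \<longleftrightarrow>
    (\<exists>p\<ge>1. 2 * p \<le> n \<and> (\<forall>k<p. v (n - 1 - k) = v (n - 1 - k - p)))" (is "?L \<longleftrightarrow> ?R")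
proof
  assume ?L
  then obtain y z where yz: "z \<noteq> []" "prefix n v = y @ z @ z" by blast
  define p where "p = length z"
  have n: "n = length y + 2 * p"
    using arg_cong [OF yz(2), of length] by (simp add: p_def)
  have nth: "v m = (y @ z @ z) ! m" if "m < n" for m
    unfolding yz(2) [symmetric] using that by simp
  have fst: "v (length y + i) = z ! i" and snd: "v (length y + (p + i)) = z ! i" if "i < p" for i
    using that n nth [of "length y + i"] nth [of "length y + (p + i)"]
    by (simp_all add: nth_append p_def)
  have "v (n - 1 - k) = v (n - 1 - k - p)" if "k < p" for k
  proof -
    have "n - 1 - k = length y + (p + (p - 1 - k))" "n - 1 - k - p = length y + (p - 1 - k)"
      using n that by linarith+
    moreover have "p - 1 - k < p" using that by linarith
    ultimately show ?thesis using fst snd by presburger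
  qed
  moreover have "p \<ge> 1" using yz(1) by (cases z) (simp_all add: p_def)
  moreover have "2 * p \<le> n" using n by linarith
  ultimately show ?R by blast
next
  assume ?R
  then obtain p where p: "p \<ge> 1" "2 * p \<le> n" "\<forall>k<p. v (n - 1 - k) = v (n - 1 - k - p)" by blast
  define m where "m = n - 2 * p"
  have n: "n = m + p + p" using p(2) unfolding m_def by linarith
  have "subsequence v (m + p) n = subsequence v m (m + p)"
  proof (rule nth_equalityI)
    fix k assume "k < length (subsequence v (m + p) n)"
    then have k: "k < p" unfolding n by simp
    have "n - 1 - (p - 1 - k) = m + p + k" "n - 1 - (p - 1 - k) - p = m + k"
      using k n by linarith+
    moreover have "p - 1 - k < p" using k by linarith
    ultimately have "v (m + p + k) = v (m + k)" using p(3) by metis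
    then show "subsequence v (m + p) n ! k = subsequence v m (m + p) ! k"
      unfolding n using k by simp
  qed (simp add: n)
  moreover have "prefix n v = prefix m v @ subsequence v m (m + p) @ subsequence v (m + p) n"
    unfolding n by (simp only: subsequence_append append_assoc)
  ultimately have "prefix n v = prefix m v @ subsequence v m (m + p) @ subsequence v m (m + p)"
    by (simp only:)
  moreover have "subsequence v m (m + p) \<noteq> []"
    using p(1) by simp
  ultimately show ?L by blast
qed

lemma curling_number_cube_free:
  assumes "u \<noteq> []" and cube: "\<And>y z. z \<noteq> [] \<Longrightarrow> u \<noteq> y @ z @ z @ z"
  shows "curling_number u = (if \<exists>y z. z \<noteq> [] \<and> u = y @ z @ z then 2 else 1)"
proof -
  have le2: "k \<le> 2" if k: "k \<in> curling_exponents u" for k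
  proof (rule ccontr)
    assume "\<not> k \<le> 2"
    \<comment> \<open>The last three copies of \<open>z\<close> form a forbidden cube.\<close>
    then obtain d where d: "k = d + 3" by (metis add.commute le_Suc_ex not_less_eq_eq numeral_2_eq_2 numeral_3_eq_3)
    obtain y z where "z \<noteq> []" "u = y @ concat (replicate k z)"
      using k by (auto simp: curling_exponents_def)
    moreover have "replicate k z = replicate d z @ [z, z, z]"
      unfolding d replicate_add by (simp add: numeral_3_eq_3)
    ultimately show False
      using cube [of z "y @ concat (replicate d z)"] by simp
  qed
  have two: "2 \<in> curling_exponents u \<longleftrightarrow> (\<exists>y z. z \<noteq> [] \<and> u = y @ z @ z)"
    by (simp add: curling_exponents_def numeral_2_eq_2)
  show ?thesis
  proof (cases "2 \<in> curling_exponents u")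
    case True
    then show ?thesis
      using two le2 finite_curling_exponents unfolding curling_number_def
      by (auto intro!: Max_eqI)
  next
    case False
    have "k \<le> 1" if "k \<in> curling_exponents u" for k
      using le2 [OF that] False that by (cases "k = 2") auto
    then have "Max (curling_exponents u) = 1"
      using one_in_curling_exponents [OF assms(1)] finite_curling_exponents
      by (intro Max_eqI) auto
    then show ?thesis
      using two False unfolding curling_number_def by auto
  qed
qed

lemma cube_free_shifted_word:
  assumes "z \<noteq> []"
  shows "prefix n shifted_word \<noteq> y @ z @ z @ z"
proof
  assume eq: "prefix n shifted_word = y @ z @ z @ z"
  define p where "p = length z"
  have n: "n = length y + 3 * p"
    using arg_cong [OF eq, of length] by (simp add: p_def)
  have nth: "shifted_word m = (y @ z @ z @ z) ! m" if "m < n" for m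
    using that by (simp flip: eq)
  have p: "p \<ge> 1" using assms by (cases z) (simp_all add: p_def)
  obtain k where k: "k < run_limit p" "shifted_word (length y + k) \<noteq> shifted_word (length y + k + p)"
    using shifted_word_run_bound [OF p] by blast
  \<comment> \<open>A cube gives \<open>2 * p\<close> consecutive matches, and
    \<open>run_limit p\<close> \<le> \<open>2 * p\<close>, with equality for \<open>p\<close> =
    1.\<close>
  have "k < 2 * p" using k(1) p by (auto simp: run_limit_def split: if_splits)
  then show False
    using k(2) nth [of "length y + k"] nth [of "length y + k + p"] n
    by (auto simp: nth_append p_def split: if_splits)
qed

text \<open>For small \<open>n\<close> the square provided by \<open>squares_end_at\<close> might
  begin before the first letter kept, so squares are exhibited by hand in the prefix 220220: 22
  ending at 1 and at 4, and the whole prefix ending at 5.\<close>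

lemma initial_squares:
  assumes "tm (n + 27)" "n < 8"
  shows "\<exists>p\<ge>1. 2 * p \<le> Suc n \<and> (\<forall>k<p. shifted_word (n - k) = shifted_word (n - k - p))"
proof -
  have start: "map block_word [21, 22, 23, 24, 25, 26] = [2, 2, 0, 2, 2, 0]"
    by (simp add: block_word_def tm.simps)
  have "\<not> tm 27" "\<not> tm 29" "\<not> tm 30" "\<not> tm 33" "\<not> tm 34"
    by (simp_all add: tm.simps)
  moreover have "n = 0 \<or> n = 1 \<or> n = 2 \<or> n = 3 \<or> n = 4 \<or> n = 5 \<or> n = 6 \<or> n = 7"
    using assms(2) by linarith
  ultimately consider "n = 1" | "n = 4" | "n = 5"
    using assms(1) by auto
  then show ?thesis
  proof cases
    case 1
    then show ?thesis using start by (intro exI [of _ 1]) (simp add: shifted_word_def)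
  next
    case 2
    then show ?thesis using start by (intro exI [of _ 1]) (simp add: shifted_word_def)
  next
    case 3
    then show ?thesis using start by (intro exI [of _ 3]) (auto simp: shifted_word_def less_Suc_eq numeral_3_eq_3)
  qed
qed

lemma shifted_word_squares:
  "(\<exists>p\<ge>1. 2 * p \<le> Suc n \<and> (\<forall>k<p. shifted_word (n - k) = shifted_word (n - k - p))) = tm (n + 27)" (is "?L = _")
proof -
  have unshift: "shifted_word (n - k) = block_word (n + 21 - k)" "shifted_word (n - k - p) = block_word (n + 21 - k - p)"
    if "k < p" "2 * p \<le> Suc n" for k p
  proof -
    have "n - k + 21 = n + 21 - k" "n - k - p + 21 = n + 21 - k - p"
      using that by linarith+
    then show "shifted_word (n - k) = block_word (n + 21 - k)" "shifted_word (n - k - p) = block_word (n + 21 - k - p)"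
      unfolding shifted_word_def by argo+
  qed
  have short: "p < 5" if p: "p \<ge> 1" "2 * p \<le> Suc n" "\<forall>k<p. shifted_word (n - k) = shifted_word (n - k - p)" for p
  proof (rule ccontr)
    assume "\<not> p < 5"
    then have lim: "run_limit p = p" by (simp add: run_limit_def)
    \<comment> \<open>A square of period \<open>p\<close> \<ge> 5 ending at \<open>n\<close> starts
      at \<open>Suc n - 2 * p\<close>, and its \<open>p\<close> matches already reach
      \<open>run_limit p\<close>.\<close>
    obtain k where k: "k < p" "shifted_word (Suc n - 2 * p + k) \<noteq> shifted_word (Suc n - 2 * p + k + p)"
      using shifted_word_run_bound [OF p(1), of "Suc n - 2 * p"] unfolding lim by blast
    have "n - (p - 1 - k) = Suc n - 2 * p + k + p" "n - (p - 1 - k) - p = Suc n - 2 * p + k"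
      using k(1) p(2) by linarith+
    moreover have "p - 1 - k < p" using k(1) by linarith
    then have "shifted_word (n - (p - 1 - k)) = shifted_word (n - (p - 1 - k) - p)" by (rule p(3) [rule_format])
    ultimately show False
      using k(2) by metis
  qed
  have L: "?L \<longleftrightarrow> (\<exists>p<5. 1 \<le> p \<and> 2 * p \<le> Suc n \<and>
      (\<forall>k<p. block_word (n + 21 - k) = block_word (n + 21 - k - p)))"
  proof
    assume ?L
    then obtain p where p: "p \<ge> 1" "2 * p \<le> Suc n" "\<forall>k<p. shifted_word (n - k) = shifted_word (n - k - p)" by blast
    have "block_word (n + 21 - k) = block_word (n + 21 - k - p)" if "k < p" for k
      using p(3) [rule_format, OF that] unfolding unshift [OF that p(2)] .
    then have "\<forall>k<p. block_word (n + 21 - k) = block_word (n + 21 - k - p)" by blast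
    with p(1,2) short [OF p] show "\<exists>p<5. 1 \<le> p \<and> 2 * p \<le> Suc n \<and>
        (\<forall>k<p. block_word (n + 21 - k) = block_word (n + 21 - k - p))"
      by (intro exI [of _ p] conjI)
  next
    assume "\<exists>p<5. 1 \<le> p \<and> 2 * p \<le> Suc n \<and> (\<forall>k<p. block_word (n + 21 - k) = block_word (n + 21 - k - p))"
    then obtain p where p: "p \<ge> 1" "2 * p \<le> Suc n" "\<forall>k<p. block_word (n + 21 - k) = block_word (n + 21 - k - p)" by blast
    have "shifted_word (n - k) = shifted_word (n - k - p)" if "k < p" for k
      using p(3) [rule_format, OF that] unfolding unshift [OF that p(2)] .
    then have "\<forall>k<p. shifted_word (n - k) = shifted_word (n - k - p)" by blast
    with p(1,2) show ?L by (intro exI [of _ p] conjI)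
  qed
  show ?thesis
  proof (cases "n < 8")
    case True
    have "tm (n + 27)" if "?L"
      using that squares_end_at [of "n + 21"] unfolding L by (simp add: add.assoc) blast
    then show ?thesis
      using initial_squares [OF _ True] by blast
  next
    case False
    then have "2 * p \<le> Suc n" if "p < 5" for p
      using that by linarith
    then have "?L \<longleftrightarrow> (\<exists>p<5. 1 \<le> p \<and> (\<forall>k<p. block_word (n + 21 - k) = block_word (n + 21 - k - p)))"
      unfolding L by blast
    moreover have "(\<exists>p<5. 1 \<le> p \<and> (\<forall>k<p. block_word (n + 21 - k) = block_word (n + 21 - k - p))) = tm (n + 21 + 6)"
      by (rule squares_end_at) simp
    moreover have "tm (n + 21 + 6) = tm (n + 27)" by (simp only: add.assoc) simp
    ultimately show ?thesis by argo
  qed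
qed

lemma curling_transform_shifted_word: "curling_transform shifted_word n = (if tm (n + 27) then 2 else 1)"
proof -
  have "curling_number (prefix (Suc n) shifted_word) =
      (if \<exists>y z. z \<noteq> [] \<and> prefix (Suc n) shifted_word = y @ z @ z then 2 else 1)"
    by (rule curling_number_cube_free) (simp, rule cube_free_shifted_word)
  then show ?thesis
    unfolding curling_transform_def square_suffix_iff using shifted_word_squares [of n] by simp
qed

theorem theorem8:
  shows "\<exists>w :: nat word. range w \<subseteq> {0, 1, 2} \<and>
    plus_free (9 / 4) w \<and> overlap_free (curling_transform w)"
proof (intro exI conjI)
  show "overlap_free (curling_transform shifted_word)"
    unfolding overlap_free_def
  proof (intro notI, elim exE conjE)
    fix u assume u: "factor_of u (curling_transform shifted_word)" "is_overlap u"
    obtain i j where ij: "i \<le> j" "u = subsequence (curling_transform shifted_word) i j"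
      using u(1) by (auto simp: factor_of_def)
    obtain a x where ax: "u = [a] @ x @ [a] @ x @ [a]"
      using u(2) by (auto simp: is_overlap_def)
    define p where "p = length ([a] @ x)"
    have len: "length u = Suc (2 * p)" by (simp add: ax p_def)
    \<comment> \<open>An overlap is a run of \<open>p + 1\<close> matches at distance
      \<open>p\<close>, and the curling values 1 and 2 determine the Thue-Morse letter at index
      shift 27 = 21 + 6.\<close>
    have "tm (i + 27 + k) = tm (i + 27 + k + p)" if "k \<le> p" for k
    proof -
      have "u ! k = u ! (k + p)"
        using that by (cases k) (simp_all add: ax p_def nth_append)
      moreover have "u ! m = curling_transform shifted_word (i + m)" if "m < Suc (2 * p)" for m
        using that len ij by simp
      ultimately have "curling_transform shifted_word (i + k) = curling_transform shifted_word (i + (k + p))"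
        using that by simp
      then show ?thesis
        by (simp add: curling_transform_shifted_word ac_simps split: if_splits)
    qed
    then show False
      using tm_overlap_free [of p "i + 27"] by (simp add: p_def)
  qed
qed (rule range_shifted_word plus_free_shifted_word)+

end
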